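(* Let $G$ be a finite simple graph. Then $G$ is locally complete 2-edge-colourable if and only if its complement $\overline{G}$ does not contain a kaleidoscope (of any order $k\ge 2$).
   Context: All graphs are finite and simple. A 2-edge-colouring of a graph $G$ is an arbitrary map $E(G)\to\{1,2\}$. It is locally complete if for each vertex $v$ and each colour $c$, the vertices joined to $v$ by edges of colour $c$ induce a complete subgraph of $G$ (equivalently, there is no monochromatic induced path with two edges). $G$ is locally complete 2-edge-colourable if it has such a colouring. A walk $W$ avoids a vertex $v$ in a graph $H$ if $W$ contains neither $v$ nor any neighbour of $v$ in $H$. A kaleidoscope of order $k$ ($k\ge 2$) in $H$ consists of (not necessarily distinct) vertices $v_0,v_1,\dots,v_{k-1}$ of $H$ together with walks $W_0,\dots,W_{k-1}$ in $H$, where $W_i$ is a $(v_i,v_{i+2})$-walk of length $\sigma(i)\geq 0$ which avoids $v_{i+1}$ (subscripts modulo $k$), such that the total length $\sum_{i=0}^{k-1}\sigma(i)$ is odd. *)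

theory Defs
  imports
    "Graph_Theory.Pair_Digraph"
    "Graph_Theory.Vertex_Walk"
    "Graph_Theory.Kuratowski"
begin

text \<open>
  A finite simple graph is a \<^locale>\<open>pair_graph\<close>: a finite, loop-free, symmetric digraph whose
  arcs are pairs of vertices. An undirected edge \<open>uv\<close> is the pair of arcs \<open>(u, v)\<close>, \<open>(v, u)\<close>;
  colourings are therefore defined on the unordered pairs \<open>{u, v}\<close>.
\<close>

definition edges :: "'a pair_pre_digraph \<Rightarrow> 'a set set" where
  "edges G = {{u, v} | u v. (u, v) \<in> parcs G}"

definition two_edge_colouring :: "'a pair_pre_digraph \<Rightarrow> ('a set \<Rightarrow> nat) \<Rightarrow> bool" where
  "two_edge_colouring G c \<longleftrightarrow> (\<forall>e\<in>edges G. c e \<in> {1, 2})"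

definition colour_nbhd :: "'a pair_pre_digraph \<Rightarrow> ('a set \<Rightarrow> nat) \<Rightarrow> nat \<Rightarrow> 'a \<Rightarrow> 'a set" where
  "colour_nbhd G c i v = {u \<in> pverts G. {v, u} \<in> edges G \<and> c {v, u} = i}"

definition induces_complete :: "'a pair_pre_digraph \<Rightarrow> 'a set \<Rightarrow> bool" where
  "induces_complete G S \<longleftrightarrow> complete_digraph (card S) (with_proj G \<restriction> S)"

definition locally_complete :: "'a pair_pre_digraph \<Rightarrow> ('a set \<Rightarrow> nat) \<Rightarrow> bool" where
  "locally_complete G c \<longleftrightarrow>
     (\<forall>v\<in>pverts G. \<forall>i\<in>{1, 2}. induces_complete G (colour_nbhd G c i v))"

definition locally_complete_2_edge_colourable :: "'a pair_pre_digraph \<Rightarrow> bool" where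
  "locally_complete_2_edge_colourable G \<longleftrightarrow> (\<exists>c. two_edge_colouring G c \<and> locally_complete G c)"

definition complement :: "'a pair_pre_digraph \<Rightarrow> 'a pair_pre_digraph" where
  "complement G = \<lparr> pverts = pverts G,
     parcs = {(u, v). u \<in> pverts G \<and> v \<in> pverts G \<and> u \<noteq> v \<and> (u, v) \<notin> parcs G} \<rparr>"

definition walk_between :: "'a pair_pre_digraph \<Rightarrow> 'a \<Rightarrow> 'a vwalk \<Rightarrow> 'a \<Rightarrow> bool" where
  "walk_between H x p y \<longleftrightarrow> vwalk p (with_proj H) \<and> hd p = x \<and> last p = y"

definition avoids :: "'a pair_pre_digraph \<Rightarrow> 'a vwalk \<Rightarrow> 'a \<Rightarrow> bool" where
  "avoids H p x \<longleftrightarrow> (\<forall>y\<in>set p. y \<noteq> x \<and> (x, y) \<notin> parcs H)"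

text \<open>Only the values of \<open>v\<close> and \<open>W\<close> at indices below \<open>k\<close> matter.\<close>

definition kaleidoscope ::
  "'a pair_pre_digraph \<Rightarrow> nat \<Rightarrow> (nat \<Rightarrow> 'a) \<Rightarrow> (nat \<Rightarrow> 'a vwalk) \<Rightarrow> bool" where
  "kaleidoscope H k v W \<longleftrightarrow>
     k \<ge> 2 \<and>
     (\<forall>i<k. v i \<in> pverts H) \<and>
     (\<forall>i<k. walk_between H (v i) (W i) (v ((i + 2) mod k)) \<and> avoids H (W i) (v ((i + 1) mod k))) \<and>
     odd (\<Sum>i<k. vwalk_length (W i))"

definition contains_kaleidoscope :: "'a pair_pre_digraph \<Rightarrow> bool" where
  "contains_kaleidoscope H \<longleftrightarrow> (\<exists>k v W. kaleidoscope H k v W)"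

lemma pair_graph_complement:
  assumes "pair_graph G"
  shows "pair_graph (complement G)"
proof -
  interpret pair_graph G by fact
  have "finite (pverts G \<times> pverts G)" by simp
  then have "finite (parcs (complement G))"
    by (rule rev_finite_subset) (auto simp: complement_def)
  then show ?thesis
    by unfold_locales
      (auto simp: complement_def symmetric_def intro!: symI dest: arcs_symmetric)
qed

lemma edges_iff:
  assumes "pair_graph G"
  shows "{u, v} \<in> edges G \<longleftrightarrow> (u, v) \<in> parcs G"
proof -
  interpret pair_graph G by fact
  show ?thesis by (auto simp: edges_def doubleton_eq_iff dest: arcs_symmetric)
qed

lemma induces_complete_iff:
  assumes "pair_graph G" and "S \<subseteq> pverts G"
  shows "induces_complete G S \<longleftrightarrow> (\<forall>x\<in>S. \<forall>y\<in>S. x \<noteq> y \<longrightarrow> (x, y) \<in> parcs G)"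
proof -
  interpret pair_graph G by fact
  have "with_proj G \<restriction> S = with_proj \<lparr> pverts = S, parcs = {(x, y) \<in> parcs G. x \<in> S \<and> y \<in> S} \<rparr>"
    by (auto simp: induce_subgraph_def with_proj_def)
  moreover have "finite S"
    using assms(2) finite_verts by (rule finite_subset)
  ultimately show ?thesis
    by (auto simp: induces_complete_def complete_digraph_pair_def dest: no_loops')
qed

lemma locally_complete_iff_no_monochromatic_induced_path:
  assumes "pair_graph G" and "two_edge_colouring G c"
  shows "locally_complete G c \<longleftrightarrow>
    \<not> (\<exists>x v y. x \<noteq> y \<and> (v, x) \<in> parcs G \<and> (v, y) \<in> parcs G \<and> (x, y) \<notin> parcs G
        \<and> c {v, x} = c {v, y})"
proof -
  interpret pair_graph G by fact
  have nbhd: "u \<in> colour_nbhd G c i v \<longleftrightarrow> (v, u) \<in> parcs G \<and> c {v, u} = i" for u i v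
    by (auto simp: colour_nbhd_def edges_iff[OF assms(1)] dest: in_arcsD2)
  have col: "c {v, u} \<in> {1, 2}" if "(v, u) \<in> parcs G" for v u
    using assms(2) that by (auto simp: two_edge_colouring_def edges_iff[OF assms(1)])
  have "locally_complete G c \<longleftrightarrow>
    (\<forall>v\<in>pverts G. \<forall>i\<in>{1, 2}. \<forall>x\<in>colour_nbhd G c i v. \<forall>y\<in>colour_nbhd G c i v.
        x \<noteq> y \<longrightarrow> (x, y) \<in> parcs G)"
    unfolding locally_complete_def
    by (intro ball_cong refl induces_complete_iff[OF assms(1)]) (auto simp: colour_nbhd_def)
  also have "\<dots> \<longleftrightarrow> (\<forall>v x y. (v, x) \<in> parcs G \<longrightarrow> (v, y) \<in> parcs G \<longrightarrow> c {v, x} = c {v, y} \<longrightarrow>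
      x \<noteq> y \<longrightarrow> (x, y) \<in> parcs G)"
    unfolding Ball_def nbhd using col by (blast dest: in_arcsD1)
  also have "\<dots> \<longleftrightarrow> \<not> (\<exists>x v y. x \<noteq> y \<and> (v, x) \<in> parcs G \<and> (v, y) \<in> parcs G \<and> (x, y) \<notin> parcs G
        \<and> c {v, x} = c {v, y})"
    by blast
  finally show ?thesis .
qed

end

theory Submission
  imports Defs
begin

text \<open>
  Call two edges of \<open>G\<close> in conflict if they form an induced path on two edges; the locally complete
  colourings are the proper 2-colourings of the conflict graph. A step \<open>a b\<close> of a walk in the
  complement that avoids \<open>x\<close> is a conflict between the edges \<open>x a\<close> and \<open>x b\<close>, so the walks of a
  kaleidoscope concatenate to an odd closed walk in the conflict graph. Conversely, an odd closed
  walk in the conflict graph, cut wherever the common endpoint of successive edges changes,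
  is a kaleidoscope, and if there is none then the parity of distances in the conflict graph is a
  2-colouring.
\<close>

text \<open>Read \<open>R n s t\<close> as: some walk of length \<open>n\<close> joins
  \<open>s\<close> to \<open>t\<close>. In each component a representative is fixed, and
  \<open>f s\<close> is the parity of one chosen walk from \<open>s\<close> to it. A walk from
  \<open>s\<close> to \<open>t\<close> closes up with the two chosen walks, and closed walks are
  even.\<close>

lemma parity_two_colouring:
  fixes R :: "nat \<Rightarrow> 's \<Rightarrow> 's \<Rightarrow> bool"
  assumes refl: "\<And>s. R 0 s s"
    and trans: "\<And>m n s t u. R m s t \<Longrightarrow> R n t u \<Longrightarrow> R (m + n) s u"
    and sym: "\<And>n s t. R n s t \<Longrightarrow> R n t s"
    and closed: "\<And>n s. R n s s \<Longrightarrow> even n"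
  obtains f :: "'s \<Rightarrow> bool" where "\<And>n s t. R n s t \<Longrightarrow> f s = f t \<longleftrightarrow> even n"
proof -
  define rep where "rep s = (SOME t. \<exists>n. R n s t)" for s
  have rep: "\<exists>n. R n s (rep s)" for s
    unfolding rep_def by (rule someI[of _ s]) (use refl in blast)
  define d where "d s = (SOME n. R n s (rep s))" for s
  have d: "R (d s) s (rep s)" for s
    unfolding d_def using rep by (rule someI_ex)
  have "even (d s) = even (d t) \<longleftrightarrow> even n" if st: "R n s t" for n s t
  proof -
    \<comment> \<open>Joined points reach the same points, so \<open>SOME\<close> picks the same
      representative for both.\<close>
    have "(\<exists>n. R n s u) = (\<exists>n. R n t u)" for u
      using trans[OF st] trans[OF sym[OF st]] by blast
    then have "rep s = rep t"
      by (simp add: rep_def)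
    then have "R (n + (d t + d s)) s s"
      using trans[OF st trans[OF d[of t]], of "d s" s] sym[OF d[of s]] by simp
    from closed[OF this] show ?thesis
      by auto
  qed
  then show thesis
    by (rule that)
qed

text \<open>
  A pair \<open>(a, x)\<close> stands for the edge \<open>a x\<close> of the graph whose complement is \<open>H\<close>, together with the
  endpoint \<open>x\<close> that the next walk has to avoid.
\<close>

inductive avoiding_chain :: "'a pair_pre_digraph \<Rightarrow> nat \<Rightarrow> 'a \<times> 'a \<Rightarrow> 'a \<times> 'a \<Rightarrow> bool"
  for H where
  refl: "avoiding_chain H 0 s s"
| step: "x \<in> pverts H \<Longrightarrow> walk_between H a p b \<Longrightarrow> avoids H p x \<Longrightarrow> avoiding_chain H n (x, b) t \<Longrightarrow>
    avoiding_chain H (vwalk_length p + n) (a, x) t"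

lemma avoiding_chain_trans:
  "avoiding_chain H m s t \<Longrightarrow> avoiding_chain H n t u \<Longrightarrow> avoiding_chain H (m + n) s u"
proof (induction rule: avoiding_chain.induct)
  case (step x a p b m t)
  then show ?case
    using avoiding_chain.step[OF step.hyps(1-3), of "m + n" u] by (simp add: add.assoc)
qed simp

lemma avoiding_chain_single:
  assumes "x \<in> pverts H" "walk_between H a p b" "avoids H p x"
  shows "avoiding_chain H (vwalk_length p) (a, x) (x, b)"
  using avoiding_chain.step[OF assms avoiding_chain.refl] by simp

text \<open>The one-vertex walk \<open>[a]\<close> avoids \<open>x\<close>; it exchanges the roles
  of the two ends of an edge at no cost in length.\<close>

lemma avoiding_chain_swap:
  assumes "a \<in> pverts H" "x \<in> pverts H" "a \<noteq> x" "(x, a) \<notin> parcs H"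
  shows "avoiding_chain H 0 (a, x) (x, a)"
  using avoiding_chain_single[of x H a "[a]" a] assms
  by (auto simp: walk_between_def avoids_def vwalk_def)

text \<open>Reversing the walk of a step from \<open>(a, x)\<close> to \<open>(x, b)\<close> yields
  a step from \<open>(b, x)\<close> to \<open>(x, a)\<close>, with both pairs in the wrong
  orientation; swaps of length 0 at the two ends repair this.\<close>

lemma avoiding_chain_sym:
  assumes "pair_graph H" "avoiding_chain H n s t"
  shows "avoiding_chain H n t s"
  using assms(2)
proof (induction rule: avoiding_chain.induct)
  case (refl s)
  show ?case by (rule avoiding_chain.refl)
next
  case (step x a p b n t)
  interpret pair_graph H by fact
  have p: "set p \<subseteq> pverts H" "p \<noteq> []" "hd p = a" "last p = b" "vwalk p (with_proj H)"
    using step.hyps by (auto simp: walk_between_def vwalk_def)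
  then have ab: "a \<in> set p" "b \<in> set p"
    by auto
  have not_arc: "(b, x) \<notin> parcs H" "(a, x) \<notin> parcs H" "a \<noteq> x" "b \<noteq> x"
    using ab step.hyps(3) arcs_symmetric unfolding avoids_def by blast+
  have "set (vwalk_arcs (rev p)) \<subseteq> parcs H"
    using p(5) by (auto simp: set_vwalk_arcs_rev vwalk_def intro: arcs_symmetric)
  then have "walk_between H b (rev p) a"
    using p by (auto simp: walk_between_def vwalk_def hd_rev last_rev)
  moreover have "avoids H (rev p) x"
    using step.hyps by (simp add: avoids_def)
  ultimately have rev_step: "avoiding_chain H (vwalk_length p) (b, x) (x, a)"
    using avoiding_chain_single[of x H b "rev p" a] step.hyps by simp
  have swap: "avoiding_chain H 0 (x, b) (b, x)" "avoiding_chain H 0 (x, a) (a, x)"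
    using ab p(1) step.hyps(1) not_arc by (auto intro!: avoiding_chain_swap)
  have "avoiding_chain H (n + (0 + (vwalk_length p + 0))) t (a, x)"
    by (intro avoiding_chain_trans[OF step.IH] avoiding_chain_trans[OF swap(1)]
        avoiding_chain_trans[OF rev_step] swap(2))
  then show ?case
    by (simp add: add.commute)
qed

text \<open>An open version of a kaleidoscope: indices are not reduced modulo \<open>k\<close>, so
  that prepending a walk is a plain shift by \<open>case_nat\<close>.\<close>

definition avoiding_walks ::
  "'a pair_pre_digraph \<Rightarrow> nat \<Rightarrow> (nat \<Rightarrow> 'a) \<Rightarrow> (nat \<Rightarrow> 'a vwalk) \<Rightarrow> bool" where
  "avoiding_walks H k v W \<longleftrightarrow>
     (\<forall>i<k. walk_between H (v i) (W i) (v (i + 2)) \<and> avoids H (W i) (v (i + 1)))"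

lemma avoiding_chain_imp_avoiding_walks:
  assumes "avoiding_chain H n s t"
  shows "\<exists>k v W. avoiding_walks H k v W \<and> v 0 = fst s \<and> v 1 = snd s \<and>
    v k = fst t \<and> v (k + 1) = snd t \<and> n = (\<Sum>i<k. vwalk_length (W i))"
  using assms
proof (induction rule: avoiding_chain.induct)
  case (refl s)
  show ?case
    by (rule exI[of _ 0], rule exI[of _ "case_nat (fst s) (\<lambda>_. snd s)"])
      (simp add: avoiding_walks_def)
next
  case (step x a p b n t)
  then obtain k v W where kvW: "avoiding_walks H k v W" "v 0 = x" "v 1 = b"
    "v k = fst t" "v (k + 1) = snd t" "n = (\<Sum>i<k. vwalk_length (W i))"
    by auto
  let ?v = "case_nat a v" and ?W = "case_nat p W"
  have "avoiding_walks H (Suc k) ?v ?W"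
    using kvW(1-3) step.hyps by (auto simp: avoiding_walks_def split: nat.split)
  moreover have "vwalk_length p + n = (\<Sum>i<Suc k. vwalk_length (?W i))"
    by (simp add: kvW(6) sum.lessThan_Suc_shift del: sum.lessThan_Suc vwalk_length_simp)
  ultimately show ?case
    using kvW(2-5)
    by (intro exI[of _ "Suc k"] exI[of _ ?v] exI[of _ ?W]) (simp del: vwalk_length_simp)
qed

lemma odd_closed_avoiding_chain_kaleidoscope:
  assumes "avoiding_chain H n s s" "odd n"
  shows "contains_kaleidoscope H"
proof -
  obtain k v W where kvW: "avoiding_walks H k v W"
    and s: "v 0 = fst s" "v 1 = snd s" "v k = fst s" "v (k + 1) = snd s"
    and n: "n = (\<Sum>i<k. vwalk_length (W i))"
    using avoiding_chain_imp_avoiding_walks[OF assms(1)] by auto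
  have W: "walk_between H (v i) (W i) (v (i + 2))" "avoids H (W i) (v (i + 1))" if "i < k" for i
    using kvW that by (auto simp: avoiding_walks_def)
  have wrap: "v k = v 0" "v (k + 1) = v 1"
    using s by auto
  have verts: "v i \<in> pverts H" and hd: "v i \<in> set (W i)" if "i < k" for i
    using W[OF that] hd_in_set[of "W i"] by (auto simp: walk_between_def vwalk_def)
  have "k \<noteq> 0"
    using assms(2) n by (cases k) auto
  \<comment> \<open>For \<open>k = 1\<close>, closing up gives \<open>v 0 = v 1\<close>, so
    \<open>W 0\<close> would start at the vertex it avoids.\<close>
  moreover have "k \<noteq> 1"
  proof
    assume "k = 1"
    then show False
      using W[of 0] hd[of 0] wrap by (auto simp: avoids_def)
  qed
  ultimately have k: "k \<ge> 2"
    by simp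
  \<comment> \<open>The last walk ends at index \<open>k + 1\<close>; \<open>wrap\<close> handles
    the two indices past the range.\<close>
  have v_mod: "v (i mod k) = v i" if "i < k + 2" for i
  proof -
    consider "i < k" | "i = k" | "i = Suc k"
      using \<open>i < k + 2\<close> by linarith
    then show ?thesis
      by cases (use k wrap in \<open>auto simp: mod_Suc\<close>)
  qed
  have "kaleidoscope H k v W"
    unfolding kaleidoscope_def
  proof (intro conjI allI impI)
    fix i assume "i < k"
    show "walk_between H (v i) (W i) (v ((i + 2) mod k))" "avoids H (W i) (v ((i + 1) mod k))"
      using W[OF \<open>i < k\<close>] v_mod[of "i + 2"] v_mod[of "i + 1"] \<open>i < k\<close> by simp_all
  qed (use k verts assms(2) n in blast)+
  then show ?thesis
    unfolding contains_kaleidoscope_def by blast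
qed

text \<open>A step from \<open>u\<close> to \<open>w\<close> is a non-edge of \<open>G\<close>
  between two neighbours of \<open>x\<close>, so local completeness gives \<open>{x, u}\<close> and
  \<open>{x, w}\<close> different colours: every step flips the colour.\<close>

lemma colour_alternates_along_avoiding_walk:
  assumes "vwalk p (with_proj (complement G))" "avoids (complement G) p x" "x \<in> pverts G"
    and "pair_graph G" "two_edge_colouring G c" "locally_complete G c"
  shows "(c {x, hd p} = 1 \<longleftrightarrow> c {x, last p} = 1) \<longleftrightarrow> even (vwalk_length p)"
  using assms(1,2)
proof (induction rule: vwalk_induct)
  case (Cons u w es)
  have uw: "(u, w) \<notin> parcs G" "u \<noteq> w" "u \<in> pverts G" "w \<in> pverts G"
    using Cons.hyps by (auto simp: complement_def)
  have xuw: "(x, u) \<in> parcs G" "(x, w) \<in> parcs G"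
    using Cons.prems uw assms(3) by (auto simp: avoids_def complement_def)
  then have "c {x, u} \<noteq> c {x, w}"
    using assms(4-6) uw locally_complete_iff_no_monochromatic_induced_path by blast
  moreover have "c {x, u} \<in> {1, 2}" "c {x, w} \<in> {1, 2}"
    using assms(4,5) xuw by (simp_all add: two_edge_colouring_def edges_iff)
  moreover have "(c {x, w} = 1 \<longleftrightarrow> c {x, last (w # es)} = 1) \<longleftrightarrow> even (length es)"
    using Cons.IH Cons.prems by (simp add: avoids_def)
  ultimately show ?case
    by auto
qed simp

lemma locally_complete_imp_no_kaleidoscope:
  assumes "pair_graph G" "two_edge_colouring G c" "locally_complete G c"
  shows "\<not> contains_kaleidoscope (complement G)"
proof
  assume "contains_kaleidoscope (complement G)"
  then obtain k v W where K: "kaleidoscope (complement G) k v W"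
    by (auto simp: contains_kaleidoscope_def)
  then have k: "k \<ge> 2" and odd: "odd (\<Sum>i<k. vwalk_length (W i))"
    by (auto simp: kaleidoscope_def)
  \<comment> \<open>The walk \<open>W i\<close> carries the colour of one edge of the cyclic
    sequence to the next; after \<open>k\<close> walks the first edge returns, so the number of
    flips must be even.\<close>
  define e where "e i \<longleftrightarrow> c {v (i mod k), v (Suc i mod k)} = 1" for i
  have alternate: "(e i \<longleftrightarrow> e (Suc i)) \<longleftrightarrow> even (vwalk_length (W i))" if "i < k" for i
  proof -
    have "v (Suc i mod k) \<in> pverts G"
      using K k by (auto simp: kaleidoscope_def complement_def)
    moreover have "vwalk (W i) (with_proj (complement G))" "hd (W i) = v i"
      "last (W i) = v (Suc (Suc i) mod k)" "avoids (complement G) (W i) (v (Suc i mod k))"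
      using K that by (auto simp: kaleidoscope_def walk_between_def)
    ultimately show ?thesis
      using colour_alternates_along_avoiding_walk[OF _ _ _ assms, of "W i" "v (Suc i mod k)"] that
      by (simp add: e_def insert_commute)
  qed
  have "(e 0 \<longleftrightarrow> e j) \<longleftrightarrow> even (\<Sum>i<j. vwalk_length (W i))" if "j \<le> k" for j
    using that
  proof (induction j)
    case (Suc j)
    then show ?case
      using alternate[of j] by (auto simp del: vwalk_length_simp)
  qed simp
  moreover have "e k = e 0"
    using k by (simp add: e_def mod_Suc)
  ultimately show False
    using odd by blast
qed

lemma no_kaleidoscope_imp_colourable:
  assumes "pair_graph G" "\<not> contains_kaleidoscope (complement G)"
  shows "locally_complete_2_edge_colourable G"
proof -
  interpret pair_graph G by fact
  let ?H = "complement G"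
  obtain f :: "'a \<times> 'a \<Rightarrow> bool"
    where f: "\<And>n s t. avoiding_chain ?H n s t \<Longrightarrow> f s = f t \<longleftrightarrow> even n"
  proof (rule parity_two_colouring[of "avoiding_chain ?H"])
    show "avoiding_chain ?H 0 s s" for s
      by (rule avoiding_chain.refl)
    show "avoiding_chain ?H (m + n) s u"
      if "avoiding_chain ?H m s t" "avoiding_chain ?H n t u" for m n s t u
      using that by (rule avoiding_chain_trans)
    show "avoiding_chain ?H n t s" if "avoiding_chain ?H n s t" for n s t
      by (rule avoiding_chain_sym[OF pair_graph_complement[OF assms(1)] that])
    show "even n" if "avoiding_chain ?H n s s" for n s
      using odd_closed_avoiding_chain_kaleidoscope that assms(2) by blast
  qed (rule that)
  \<comment> \<open>\<open>f\<close> is defined on oriented pairs, so \<open>SOME\<close> picks an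
    orientation; by \<open>swap\<close> the choice is immaterial on edges of
    \<open>G\<close>.\<close>
  define c :: "'a set \<Rightarrow> nat" where
    "c e = (if f (SOME (u, w). e = {u, w}) then 1 else 2)" for e
  have swap: "f (u, w) = f (w, u)" if "(u, w) \<in> parcs G" for u w
  proof -
    have "avoiding_chain ?H 0 (u, w) (w, u)"
      using that arcs_symmetric[OF that] by (intro avoiding_chain_swap)
        (auto simp: complement_def dest: no_loops' in_arcsD1 in_arcsD2)
    then show ?thesis
      using f by fastforce
  qed
  have c: "c {x, u} = (if f (u, x) then 1 else 2)" if "(x, u) \<in> parcs G" for x u
  proof -
    have "case (SOME (a, b). {x, u} = {a, b}) of (a, b) \<Rightarrow> {x, u} = {a, b}"
      by (rule someI[of _ "(x, u)"]) simp
    then have "(SOME (a, b). {x, u} = {a, b}) \<in> {(x, u), (u, x)}"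
      by (auto simp: doubleton_eq_iff split: prod.splits)
    then show ?thesis
      using swap[OF that] unfolding c_def by (metis empty_iff insert_iff)
  qed
  have "c {x, u} \<noteq> c {x, w}"
    if "u \<noteq> w" "(x, u) \<in> parcs G" "(x, w) \<in> parcs G" "(u, w) \<notin> parcs G" for x u w
  proof -
    \<comment> \<open>An induced path \<open>u x w\<close> of \<open>G\<close> is a walk of odd
      length 1 in the complement that avoids \<open>x\<close>.\<close>
    have "avoiding_chain ?H (vwalk_length [u, w]) (u, x) (x, w)"
      using that by (intro avoiding_chain_single)
        (auto simp: walk_between_def avoids_def vwalk_def complement_def
          dest: in_arcsD1 in_arcsD2 no_loops')
    then have "f (u, x) \<noteq> f (x, w)"
      using f by fastforce
    then show ?thesis
      using c swap that by auto
  qed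
  moreover have col: "two_edge_colouring G c"
    by (simp add: two_edge_colouring_def c_def)
  ultimately have "locally_complete G c"
    using locally_complete_iff_no_monochromatic_induced_path[OF assms(1)] by blast
  then show ?thesis
    using col by (auto simp: locally_complete_2_edge_colourable_def)
qed

theorem theorem4:
  fixes G :: "'a pair_pre_digraph"
  assumes "pair_graph G"
  shows "locally_complete_2_edge_colourable G \<longleftrightarrow> \<not> contains_kaleidoscope (complement G)"
  using assms locally_complete_imp_no_kaleidoscope no_kaleidoscope_imp_colourable
  unfolding locally_complete_2_edge_colourable_def by blast

end
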